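(* Let $r,m,n\ge 1$ be integers, and let $p_1,\dots,p_r$ and $g_1,\dots,g_m$ be convex real polynomials on $\mathbb{R}^n$ such that $\mathcal F:=\{x\in\mathbb{R}^n : g_i(x)\le 0,\ i=1,\dots,m\}\neq\emptyset$. Let $\Delta:=\{\delta\in\mathbb{R}^r_+ : \sum_{j=1}^r\delta_j=1\}$. Then the following statements are equivalent: (i) For every $x\in\mathbb{R}^n$, if $g_i(x)\le 0$ for all $i=1,\dots,m$, then $\max_{1\le j\le r}p_j(x)\ge 0$. (ii) For every $\varepsilon>0$ there exist $\bar\delta\in\Delta$ and $\bar\lambda\in\mathbb{R}^m_+$ such that $\sum_{j=1}^r\bar\delta_j p_j(x)+\sum_{i=1}^m\bar\lambda_i g_i(x)+\varepsilon>0$ for all $x\in\mathbb{R}^n$.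
   Context: $\mathbb{R}^k_+$ denotes the set of vectors in $\mathbb{R}^k$ with nonnegative coordinates. *)

theory Defs
  imports "HOL-Analysis.Analysis"
begin

definition nonneg_orthant :: "(real ^ 'k) set" where
  "nonneg_orthant = {v. \<forall>i. 0 \<le> v $ i}"

definition prob_simplex :: "(real ^ 'r) set" where
  "prob_simplex = {\<delta> \<in> nonneg_orthant. (\<Sum>j\<in>UNIV. \<delta> $ j) = 1}"

(* Polynomials on R^n are taken as functions: real_polynomial_function is the class generated
   by bounded linear functionals and constants under addition and multiplication. *)
definition convex_polynomial :: "(real ^ 'n \<Rightarrow> real) \<Rightarrow> bool" where
  "convex_polynomial f \<longleftrightarrow> real_polynomial_function f \<and> convex_on UNIV f"

definition feasible_set :: "('m \<Rightarrow> real ^ 'n \<Rightarrow> real) \<Rightarrow> (real ^ 'n) set" where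
  "feasible_set g = {x. \<forall>i. g i x \<le> 0}"

end

(* A convex polynomial that is bounded above along one ray in direction d is affine along every
   line in direction d, with one common slope c <= 0. Hence a finite system f i x <= 0 of convex
   polynomial inequalities that is solvable up to every positive error is solvable: if the approximate solution sets are unbounded, a recession direction
   d either has all slopes 0, and one passes to the orthogonal complement of d, or satisfies the
   inequalities of negative slope for free far out along d, and these can be dropped.
   So if p j x + \<epsilon> <= 0, g i x <= 0 has no solution, then 0 is not in the closure of the convex
   set of all (y, z) with p j x + \<epsilon> <= y j and g i x <= z i for some x. Strict separation gives the
   multipliers; feasibility forces the weights of the p j to have positive sum. *)

theory Submission
  imports Defs
begin

section \<open>Rays in convex sets, and convex polynomials along rays\<close>

text \<open>The unit directions from \<open>a\<close> to points of \<open>S\<close> ever farther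
  away accumulate on the compact sphere. Convexity keeps the segments to those points in
  \<open>S\<close>, and closedness passes to the limit.\<close>

lemma unbounded_closed_convex_contains_ray:
  fixes S :: "'a::euclidean_space set"
  assumes S: "closed S" "convex S" "\<not> bounded S" and a: "a \<in> S"
  obtains d where "norm d = 1" "\<And>t. t \<ge> 0 \<Longrightarrow> a + t *\<^sub>R d \<in> S"
proof -
  have "\<exists>x\<in>S. norm (x - a) > real n" for n :: nat
  proof (rule ccontr)
    assume "\<not> ?thesis"
    then have "S \<subseteq> cball a (real n)"
      by (auto simp: dist_norm norm_minus_commute not_less)
    then show False
      using S(3) bounded_subset bounded_cball by blast
  qed
  then obtain x where x: "\<And>n. x n \<in> S" "\<And>n. norm (x n - a) > real n"
    by metis
  define e where "e n = (x n - a) /\<^sub>R norm (x n - a)" for n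
  have pos: "norm (x n - a) > 0" for n
    using x(2)[of n] by linarith
  have "\<forall>n. e n \<in> sphere 0 1"
    using pos by (simp add: e_def)
  then obtain d r where d: "d \<in> sphere 0 1" and r: "strict_mono r" and lim: "(e \<circ> r) \<longlonglongrightarrow> d"
    using compact_sphere[of "0::'a" 1] unfolding compact_def by blast
  have "a + t *\<^sub>R d \<in> S" if t: "t \<ge> 0" for t
  proof (rule Lim_in_closed_set[OF \<open>closed S\<close>])
    show "(\<lambda>n. a + t *\<^sub>R e (r n)) \<longlonglongrightarrow> a + t *\<^sub>R d"
      using lim by (intro tendsto_intros) (simp add: o_def)
    \<comment> \<open>This is the point at distance \<open>t\<close> from \<open>a\<close> on the
      segment to \<open>x (r n)\<close>. For large \<open>n\<close> the segment is longer than
      \<open>t\<close>, since its length exceeds \<open>r n\<close>, which is at least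
      \<open>n\<close>.\<close>
    have "a + t *\<^sub>R e (r n) \<in> S" if "n \<ge> nat \<lceil>t\<rceil>" for n
    proof -
      let ?u = "t / norm (x (r n) - a)"
      have "t \<le> real (r n)"
        using that seq_suble[OF r, of n] by linarith
      then have u: "0 \<le> ?u" "?u \<le> 1"
        using t x(2)[of "r n"] pos[of "r n"] by (auto simp: divide_simps)
      have "(1 - ?u) *\<^sub>R a + ?u *\<^sub>R x (r n) \<in> S"
        using convexD_alt[OF S(2) a x(1) u] .
      also have "(1 - ?u) *\<^sub>R a + ?u *\<^sub>R x (r n) = a + t *\<^sub>R e (r n)"
        by (simp add: e_def divide_inverse algebra_simps)
      finally show ?thesis .
    qed
    then show "\<forall>\<^sub>F n in sequentially. a + t *\<^sub>R e (r n) \<in> S"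
      unfolding eventually_sequentially by blast
  qed simp
  then show thesis
    using d that by simp
qed

text \<open>The offset \<open>M\<close> enters with a weight that vanishes in the limit, so
  \<open>f x\<close> takes its place, while the growth rate \<open>c\<close> survives. With
  \<open>c = 0\<close> this spreads boundedness on one ray to all parallel rays; with
  \<open>M = f y\<close> it compares slopes on parallel lines.\<close>

lemma convex_on_linear_growth_along_ray:
  fixes f :: "'a::real_normed_vector \<Rightarrow> real"
  assumes f: "convex_on UNIV f" "\<And>x. isCont f x"
    and bound: "\<And>t. t \<ge> 0 \<Longrightarrow> f (y + t *\<^sub>R d) \<le> M + t * c" and t: "t \<ge> 0"
  shows "f (x + t *\<^sub>R d) \<le> f x + t * c"
proof -
  have "((\<lambda>s. (1 - s) *\<^sub>R x + s *\<^sub>R y + t *\<^sub>R d) \<longlongrightarrow> (1 - 0) *\<^sub>R x + 0 *\<^sub>R y + t *\<^sub>R d) (at_right 0)"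
    by (intro tendsto_intros)
  then have "((\<lambda>s. (1 - s) *\<^sub>R x + s *\<^sub>R y + t *\<^sub>R d) \<longlongrightarrow> x + t *\<^sub>R d) (at_right 0)"
    by simp
  then have l: "((\<lambda>s. f ((1 - s) *\<^sub>R x + s *\<^sub>R y + t *\<^sub>R d)) \<longlongrightarrow> f (x + t *\<^sub>R d)) (at_right 0)"
    using isCont_tendsto_compose[OF f(2)] by blast
  have "((\<lambda>s. (1 - s) * f x + s * M + t * c) \<longlongrightarrow> (1 - 0) * f x + 0 * M + t * c) (at_right 0)"
    by (intro tendsto_intros)
  then have u: "((\<lambda>s. (1 - s) * f x + s * M + t * c) \<longlongrightarrow> f x + t * c) (at_right 0)"
    by simp
  \<comment> \<open>Move from \<open>x\<close> towards the far point \<open>y + (t / s) d\<close> and let \<open>s\<close> tend to 0.\<close>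
  have le: "f ((1 - s) *\<^sub>R x + s *\<^sub>R y + t *\<^sub>R d) \<le> (1 - s) * f x + s * M + t * c"
    if s: "0 < s" "s < 1" for s
  proof -
    have "f ((1 - s) *\<^sub>R x + s *\<^sub>R (y + (t / s) *\<^sub>R d)) \<le> (1 - s) * f x + s * f (y + (t / s) *\<^sub>R d)"
      using s by (intro convex_onD[OF f(1)]) auto
    also have "\<dots> \<le> (1 - s) * f x + s * (M + (t / s) * c)"
      using s t bound[of "t / s"] by simp
    finally show ?thesis
      using s by (simp add: algebra_simps)
  qed
  show ?thesis
  proof (rule tendsto_le[OF _ u l])
    show "\<forall>\<^sub>F s in at_right 0. f ((1 - s) *\<^sub>R x + s *\<^sub>R y + t *\<^sub>R d) \<le> (1 - s) * f x + s * M + t * c"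
      using le by (auto simp: eventually_at_right_field intro!: exI[of _ 1])
  qed simp
qed

text \<open>After factoring out \<open>t\<close>, the quotient polynomial is bounded by
  \<open>K\<close> for positive \<open>t\<close>, whereas a nonconstant polynomial is unbounded at
  infinity. So all its coefficients above the constant one vanish.\<close>

lemma real_polynomial_function_linear_growth_imp_affine:
  fixes \<phi> :: "real \<Rightarrow> real"
  assumes \<phi>: "real_polynomial_function \<phi>"
    and bound: "\<And>t. t \<ge> 0 \<Longrightarrow> \<bar>\<phi> t - \<phi> 0\<bar> \<le> K * t"
  shows "\<exists>c. \<forall>t. \<phi> t = \<phi> 0 + t * c"
proof -
  obtain a n where a: "\<phi> = (\<lambda>x. \<Sum>i\<le>n. a i * x ^ i)"
    using \<phi> real_polynomial_function_iff_sum by blast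
  show ?thesis
  proof (cases n)
    case 0
    then show ?thesis
      using a by simp
  next
    case (Suc m)
    have \<phi>_eq: "\<phi> t = \<phi> 0 + t * (\<Sum>i\<le>m. a (Suc i) * t ^ i)" for t
      by (simp add: a Suc sum.atMost_Suc_shift sum_distrib_left mult_ac del: sum.atMost_Suc)
    have zero: "a (Suc k) = 0" if k: "1 \<le> k" "k \<le> m" for k
    proof (rule ccontr)
      assume "a (Suc k) \<noteq> 0"
      then have "\<forall>\<^sub>F z in at_infinity. K + 1 \<le> norm (\<Sum>i\<le>m. a (Suc i) * z ^ i)"
        using k by (intro Limits.polyfun_extremal[where c = "\<lambda>i. a (Suc i)" and k = k])
      then obtain b where b: "\<And>z. b \<le> \<bar>z\<bar> \<Longrightarrow> K + 1 \<le> \<bar>\<Sum>i\<le>m. a (Suc i) * z ^ i\<bar>"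
        by (auto simp: eventually_at_infinity)
      \<comment> \<open>Large enough for the lower bound on the quotient, and positive so that the
        linear growth bound applies and \<open>z\<close> can be cancelled.\<close>
      define z where "z = max b 1"
      have z: "z > 0" "b \<le> \<bar>z\<bar>"
        by (auto simp: z_def)
      have "z * \<bar>\<Sum>i\<le>m. a (Suc i) * z ^ i\<bar> \<le> z * K"
        using bound[of z] z \<phi>_eq[of z] by (simp add: abs_mult mult.commute)
      then show False
        using b[OF z(2)] z(1) by simp
    qed
    have low: "(\<Sum>i\<le>m. a (Suc i) * t ^ i) = (\<Sum>i\<in>{0}. a (Suc i) * t ^ i)" for t
      by (rule sum.mono_neutral_right) (auto simp: zero)
    have "\<phi> t = \<phi> 0 + t * a (Suc 0)" for t
      by (subst \<phi>_eq) (simp add: low)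
    then show ?thesis
      by blast
  qed
qed

lemma convex_polynomial_isCont: "convex_polynomial f \<Longrightarrow> isCont f x"
  by (simp add: convex_polynomial_def continuous_real_polymonial_function)

text \<open>Boundedness on one ray makes \<open>f\<close> nonincreasing in direction
  \<open>d\<close> everywhere; convexity limits the rate of decrease to a linear one. A polynomial
  of linear growth is affine. Being a polynomial matters: exp(-t) is convex and bounded for t >= 0,
  but not affine.\<close>

lemma convex_polynomial_affine_along_bounded_ray:
  fixes f :: "real ^ 'n \<Rightarrow> real"
  assumes f: "convex_polynomial f" and bound: "\<And>t. t \<ge> 0 \<Longrightarrow> f (y + t *\<^sub>R d) \<le> M"
  obtains c where "c \<le> 0" "\<And>x t. f (x + t *\<^sub>R d) = f x + t * c"
proof -
  have conv: "convex_on UNIV f" and poly: "real_polynomial_function f"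
    using f by (auto simp: convex_polynomial_def)
  have le: "f (x + t *\<^sub>R d) \<le> f x" if "t \<ge> 0" for x t
    using convex_on_linear_growth_along_ray[OF conv convex_polynomial_isCont[OF f], of y d M 0 t x]
      bound that by simp
  have "\<exists>c. \<forall>t. f (x + t *\<^sub>R d) = f x + t * c" for x
  proof -
    have "polynomial_function (\<lambda>t. x + t *\<^sub>R d)"
      by (intro polynomial_function_add polynomial_function_const polynomial_function_bounded_linear
          bounded_linear_scaleR_left)
    then have "real_polynomial_function (\<lambda>t. f (x + t *\<^sub>R d))"
      using real_polynomial_function_compose[OF _ poly] by (force simp: o_def)
    moreover have "\<bar>f (x + t *\<^sub>R d) - f (x + 0 *\<^sub>R d)\<bar> \<le> (f (x - d) - f x) * t" if t: "t \<ge> 0" for t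
    proof -
      \<comment> \<open>The weight for which the combination of \<open>x + t *\<^sub>R d\<close> and
        \<open>x - d\<close> is \<open>x\<close> itself: it solves (1 - u) t = u.\<close>
      let ?u = "t / (1 + t)"
      have "f ((1 - ?u) *\<^sub>R (x + t *\<^sub>R d) + ?u *\<^sub>R (x - d)) \<le> (1 - ?u) * f (x + t *\<^sub>R d) + ?u * f (x - d)"
        using t by (intro convex_onD[OF conv]) auto
      moreover have "(1 - ?u) *\<^sub>R (x + t *\<^sub>R d) + ?u *\<^sub>R (x - d) = x + ((1 - ?u) * t - ?u) *\<^sub>R d"
        by (simp add: algebra_simps)
      moreover have "1 - ?u = 1 / (1 + t)"
        using t by (simp add: field_simps)
      ultimately have "f x \<le> (f (x + t *\<^sub>R d) + t * f (x - d)) / (1 + t)"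
        by (simp add: add_divide_distrib)
      then have "f x * (1 + t) \<le> f (x + t *\<^sub>R d) + t * f (x - d)"
        using t by (simp add: pos_le_divide_eq)
      then show ?thesis
        using le[OF t, of x] by (simp add: algebra_simps)
    qed
    ultimately have "\<exists>c. \<forall>t. f (x + t *\<^sub>R d) = f (x + 0 *\<^sub>R d) + t * c"
      by (rule real_polynomial_function_linear_growth_imp_affine)
    then show ?thesis
      by simp
  qed
  then obtain c where c: "\<And>x t. f (x + t *\<^sub>R d) = f x + t * c x"
    by metis
  \<comment> \<open>The exact growth along the line through \<open>z\<close> serves as the bound for
    the ray from \<open>x\<close>. Exchanging the two points makes all slopes equal.\<close>
  have c_le: "c x \<le> c z" for x z
    using convex_on_linear_growth_along_ray[OF conv convex_polynomial_isCont[OF f], of z d "f z" "c z" 1 x]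
    by (simp add: c c[of x 1, simplified])
  show thesis
  proof (rule that)
    show "c 0 \<le> 0"
      using le[of 1 0] c[of 0 1] by simp
    show "f (x + t *\<^sub>R d) = f x + t * c 0" for x t
      using c c_le[of x 0] c_le[of 0 x] by simp
  qed
qed

section \<open>From approximate to exact solvability of convex polynomial systems\<close>

text \<open>The subspace \<open>V\<close> lets the dimension drop within one fixed type. The measure
  \<open>dim V + card I\<close> decreases both when a direction is split off and when inequalities
  are dropped. For general convex functions the claim fails, as exp(-x) <= 0 shows.\<close>

lemma convex_polynomial_system_attained:
  fixes f :: "'i \<Rightarrow> real ^ 'n \<Rightarrow> real"
  assumes "finite I" "subspace V" "\<And>i. i \<in> I \<Longrightarrow> convex_polynomial (f i)"
    and "\<And>\<eta>. \<eta> > 0 \<Longrightarrow> \<exists>x\<in>V. \<forall>i\<in>I. f i x \<le> \<eta>"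
  shows "\<exists>x\<in>V. \<forall>i\<in>I. f i x \<le> 0"
  using assms
proof (induction "dim V + card I" arbitrary: V I rule: less_induct)
  case less
  define S where "S \<eta> = {x \<in> V. \<forall>i\<in>I. f i x \<le> \<eta>}" for \<eta>
  have S_Int: "S \<eta> = V \<inter> (\<Inter>i\<in>I. {x. f i x \<le> \<eta>})" for \<eta>
    by (auto simp: S_def)
  have S_mono: "S \<eta> \<subseteq> S \<eta>'" if "\<eta> \<le> \<eta>'" for \<eta> \<eta>'
    using that by (fastforce simp: S_def)
  have cont: "continuous_on UNIV (f i)" if "i \<in> I" for i
    using less.prems(3)[OF that] convex_polynomial_isCont by (auto intro: continuous_at_imp_continuous_on)
  have closed: "closed (S \<eta>)" for \<eta>
    unfolding S_Int
    by (intro closed_Int closed_subspace less.prems closed_INT ballI closed_Collect_le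
        continuous_on_const cont)
  have "convex {x. f i x \<le> \<eta>}" if "i \<in> I" for i \<eta>
    unfolding convex_alt
  proof clarify
    fix x y and u :: real
    assume "f i x \<le> \<eta>" "f i y \<le> \<eta>" and u: "0 \<le> u" "u \<le> 1"
    then have "(1 - u) * f i x + u * f i y \<le> \<eta>"
      by (intro convex_bound_le) auto
    moreover have "f i ((1 - u) *\<^sub>R x + u *\<^sub>R y) \<le> (1 - u) * f i x + u * f i y"
      using less.prems(3)[OF that] u by (intro convex_onD[of UNIV "f i"]) (auto simp: convex_polynomial_def)
    ultimately show "f i ((1 - u) *\<^sub>R x + u *\<^sub>R y) \<le> \<eta>"
      by linarith
  qed
  then have convex: "convex (S \<eta>)" for \<eta>
    unfolding S_Int using subspace_imp_convex[OF less.prems(2)] by (intro convex_Int convex_INT)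
  show ?case
  proof (cases "bounded (S 1)")
    case True
    \<comment> \<open>Cantor's intersection theorem: these sets are nonempty, nested, and compact as
      closed subsets of the bounded \<open>S 1\<close>. A common point has error at most
      \<open>1 / Suc n\<close> for every \<open>n\<close>.\<close>
    have "\<Inter>(range (\<lambda>n. S (1 / Suc n))) \<noteq> {}"
    proof (rule compact_nest)
      show "compact (S (1 / Suc n))" for n
        using True closed bounded_subset[OF _ S_mono[of "1 / Suc n" 1]]
        by (simp add: compact_eq_bounded_closed)
      show "S (1 / Suc n) \<noteq> {}" for n
        using less.prems(4)[of "1 / Suc n"] by (auto simp: S_def)
      show "S (1 / Suc n) \<subseteq> S (1 / Suc m)" if "m \<le> n" for m n
        using that by (intro S_mono) (simp add: frac_le)
    qed
    then obtain x where x: "\<And>n. x \<in> S (1 / Suc n)"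
      by auto
    have "f i x \<le> 0" if "i \<in> I" for i
    proof (rule LIMSEQ_le_const)
      show "(\<lambda>n. 1 / real (Suc n)) \<longlonglongrightarrow> 0"
        by (rule lim_1_over_n[THEN LIMSEQ_Suc])
      show "\<exists>N. \<forall>n\<ge>N. f i x \<le> 1 / real (Suc n)"
        using x that by (auto simp: S_def)
    qed
    then show ?thesis
      using x[of 0] by (auto simp: S_def)
  next
    case False
    obtain a where a: "a \<in> S 1"
      using less.prems(4)[of 1] by (auto simp: S_def)
    obtain d where d: "norm d = 1" "\<And>t. t \<ge> 0 \<Longrightarrow> a + t *\<^sub>R d \<in> S 1"
      using unbounded_closed_convex_contains_ray[OF closed convex False a] by metis
    have "a + 1 *\<^sub>R d - a \<in> V"
      using d(2)[of 1] a by (intro subspace_diff less.prems) (auto simp: S_def)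
    then have dV: "d \<in> V"
      by simp
    have "\<exists>c\<le>0. \<forall>x t. f i (x + t *\<^sub>R d) = f i x + t * c" if i: "i \<in> I" for i
    proof (rule convex_polynomial_affine_along_bounded_ray[OF less.prems(3)[OF i]])
      show "f i (a + t *\<^sub>R d) \<le> 1" if "t \<ge> 0" for t
        using d(2)[OF that] i by (auto simp: S_def)
    qed blast
    then obtain c where c: "\<And>i. i \<in> I \<Longrightarrow> c i \<le> 0"
      and fd: "\<And>i x t. i \<in> I \<Longrightarrow> f i (x + t *\<^sub>R d) = f i x + t * c i"
      by metis
    show ?thesis
    proof (cases "\<forall>i\<in>I. c i = 0")
      case True
      define W where "W = V \<inter> {x. d \<bullet> x = 0}"
      have W: "subspace W"
        unfolding W_def by (intro subspace_inter less.prems subspace_hyperplane)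
      have "d \<notin> W"
        using d(1) by (auto simp: W_def)
      then have "W \<subset> V"
        using dV by (metis W_def Int_lower1 psubsetI)
      then have "dim W < dim V"
        by (metis W less.prems(2) dim_psubset span_eq_iff)
      moreover have "\<exists>x\<in>W. \<forall>i\<in>I. f i x \<le> \<eta>" if \<eta>: "\<eta> > 0" for \<eta>
      proof -
        obtain x where x: "x \<in> V" "\<And>i. i \<in> I \<Longrightarrow> f i x \<le> \<eta>"
          using less.prems(4)[OF \<eta>] by blast
        \<comment> \<open>The orthogonal projection of \<open>x\<close> along \<open>d\<close>. With
          all slopes 0 this shift changes no \<open>f i\<close>.\<close>
        define z where "z = x + (- (d \<bullet> x)) *\<^sub>R d"
        have "d \<bullet> d = 1"
          using d(1) by (simp add: dot_square_norm)
        then have "d \<bullet> z = 0"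
          by (simp add: z_def inner_diff_right)
        moreover have "z \<in> V"
          unfolding z_def using x(1) dV less.prems(2)
          by (intro subspace_add subspace_scale)
        moreover have "f i z = f i x" if "i \<in> I" for i
          using fd[OF that] True that by (simp add: z_def del: scaleR_minus_left)
        ultimately show ?thesis
          using x(2) by (auto simp: W_def intro!: bexI[of _ z])
      qed
      ultimately have "\<exists>x\<in>W. \<forall>i\<in>I. f i x \<le> 0"
        using less.hyps[of W I] less.prems W by simp
      then show ?thesis
        by (auto simp: W_def)
    next
      case False
      define J where "J = {i \<in> I. c i = 0}"
      have "J \<subset> I"
        using False by (auto simp: J_def)
      then have "card J < card I"
        by (simp add: less.prems(1) psubset_card_mono)
      moreover have "\<exists>x\<in>V. \<forall>i\<in>J. f i x \<le> \<eta>" if "\<eta> > 0" for \<eta>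
        using less.prems(4)[OF that] \<open>J \<subset> I\<close> by blast
      moreover have "finite J" "\<And>i. i \<in> J \<Longrightarrow> convex_polynomial (f i)"
        using less.prems by (auto simp: J_def)
      ultimately have "\<exists>x\<in>V. \<forall>i\<in>J. f i x \<le> 0"
        using less.prems(2) by (intro less.hyps[of V J]) auto
      then obtain x where x: "x \<in> V" "\<And>i. i \<in> J \<Longrightarrow> f i x \<le> 0"
        by blast
      \<comment> \<open>Inequalities in \<open>J\<close> are unaffected by moving along
        \<open>d\<close>; each of the others holds once its negative slope has used up
        \<open>f i x\<close>. As \<open>I\<close> is finite, one \<open>s\<close> beyond all
        thresholds serves every \<open>i\<close>.\<close>
      have "\<exists>t. \<forall>s\<ge>t. f i (x + s *\<^sub>R d) \<le> 0" if i: "i \<in> I" for i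
      proof (cases "i \<in> J")
        case True
        then show ?thesis
          using x(2) i fd[OF i] by (auto simp: J_def)
      next
        case False
        then have neg: "c i < 0"
          using c[OF i] i by (auto simp: J_def)
        have "f i (x + s *\<^sub>R d) \<le> 0" if "s \<ge> f i x / (- c i)" for s
          using that neg fd[OF i] by (simp add: field_simps)
        then show ?thesis
          by blast
      qed
      then obtain t where t: "\<And>i s. i \<in> I \<Longrightarrow> s \<ge> t i \<Longrightarrow> f i (x + s *\<^sub>R d) \<le> 0"
        by metis
      define s where "s = Max (insert 0 (t ` I))"
      have "s \<ge> t i" if "i \<in> I" for i
        using that less.prems(1) by (simp add: s_def)
      moreover have "x + s *\<^sub>R d \<in> V"
        using x(1) dV less.prems(2) by (intro subspace_add subspace_scale)
      ultimately show ?thesis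
        using t by blast
    qed
  qed
qed

section \<open>A theorem of the alternative by separation\<close>

lemma convex_polynomial_add_const:
  assumes "convex_polynomial f"
  shows "convex_polynomial (\<lambda>x. f x + c)"
proof -
  have f: "real_polynomial_function f" "convex_on UNIV f"
    using assms by (simp_all add: convex_polynomial_def)
  have "real_polynomial_function (\<lambda>x. f x + c)"
    by (rule real_polynomial_function.intros(3)[OF f(1) real_polynomial_function.intros(2)])
  moreover have "convex_on UNIV (\<lambda>x. f x + c)"
    by (rule convex_on_add[OF f(2) iffD2[OF convex_on_const convex_UNIV]])
  ultimately show ?thesis
    by (simp add: convex_polynomial_def)
qed

text \<open>By exact solvability, infeasibility keeps the origin out of the closure of
  \<open>\<Omega>\<close>, not merely out of \<open>\<Omega>\<close>. Hence the separation is
  strict, which yields the uniform margin \<open>b\<close>.\<close>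

lemma convex_polynomial_systems_alternative:
  fixes p :: "'r::finite \<Rightarrow> real ^ 'n \<Rightarrow> real" and g :: "'m::finite \<Rightarrow> real ^ 'n \<Rightarrow> real"
  assumes p: "\<And>j. convex_polynomial (p j)" and g: "\<And>i. convex_polynomial (g i)"
    and infeasible: "\<nexists>x. (\<forall>j. p j x \<le> 0) \<and> (\<forall>i. g i x \<le> 0)"
  shows "\<exists>\<delta>\<in>nonneg_orthant. \<exists>\<mu>\<in>nonneg_orthant. \<exists>b>0.
    \<forall>x. (\<Sum>j\<in>UNIV. \<delta> $ j * p j x) + (\<Sum>i\<in>UNIV. \<mu> $ i * g i x) > b"
proof -
  \<comment> \<open>Allowing all larger values, not just those attained by \<open>p\<close> and
    \<open>g\<close>, makes the set convex and also forces the multipliers to be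
    nonnegative.\<close>
  define \<Omega> :: "((real ^ 'r) \<times> (real ^ 'm)) set"
    where "\<Omega> = {(y, z). \<exists>x. (\<forall>j. p j x \<le> y $ j) \<and> (\<forall>i. g i x \<le> z $ i)}"
  have conv: "convex_on UNIV (p j)" "convex_on UNIV (g i)" for i j
    using p g by (auto simp: convex_polynomial_def)
  have comb: "f ((1 - u) *\<^sub>R x + u *\<^sub>R x') \<le> (1 - u) * y + u * y'"
    if "convex_on UNIV f" "f x \<le> y" "f x' \<le> y'" "0 \<le> u" "u \<le> 1"
    for f :: "real ^ 'n \<Rightarrow> real" and x x' y y' u
    using convex_onD[OF that(1), of u x x'] that
      mult_left_mono[OF that(2), of "1 - u"] mult_left_mono[OF that(3), of u] by simp
  have "convex \<Omega>"
    unfolding convex_alt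
  proof safe
    fix y y' z z' and u :: real
    assume u: "0 \<le> u" "u \<le> 1" and "(y, z) \<in> \<Omega>" "(y', z') \<in> \<Omega>"
    then obtain x x' where "\<And>j. p j x \<le> y $ j" "\<And>i. g i x \<le> z $ i"
      "\<And>j. p j x' \<le> y' $ j" "\<And>i. g i x' \<le> z' $ i"
      by (auto simp: \<Omega>_def)
    then show "(1 - u) *\<^sub>R (y, z) + u *\<^sub>R (y', z') \<in> \<Omega>"
      using u comb conv by (auto simp: \<Omega>_def intro!: exI[of _ "(1 - u) *\<^sub>R x + u *\<^sub>R x'"])
  qed
  have "0 \<notin> closure \<Omega>"
  proof
    assume cl: "0 \<in> closure \<Omega>"
    \<comment> \<open>A point of \<open>\<Omega>\<close> within \<eta> of the origin has all
      coordinates below \<eta>, so its witness solves the system up to \<eta>. The sum type merges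
      \<open>p\<close> and \<open>g\<close> into one family.\<close>
    have "\<exists>x\<in>UNIV. \<forall>k\<in>UNIV. case_sum p g k x \<le> \<eta>" if "\<eta> > 0" for \<eta>
    proof -
      obtain y z where yz: "(y, z) \<in> \<Omega>" "norm (y, z) < \<eta>"
        using cl \<open>\<eta> > 0\<close> by (fastforce simp: closure_approachable dist_norm)
      then obtain x where x: "\<And>j. p j x \<le> y $ j" "\<And>i. g i x \<le> z $ i"
        by (auto simp: \<Omega>_def)
      have "y $ j \<le> \<eta>" for j
        using component_le_norm_cart[of y j] norm_fst_le[of y z] yz(2) by linarith
      moreover have "z $ i \<le> \<eta>" for i
        using component_le_norm_cart[of z i] norm_snd_le[of z y] yz(2) by linarith
      ultimately have "\<And>j. p j x \<le> \<eta>" "\<And>i. g i x \<le> \<eta>"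
        using x order_trans by blast+
      then show ?thesis
        by (auto split: sum.split)
    qed
    then have "\<exists>x\<in>UNIV. \<forall>k\<in>UNIV. case_sum p g k x \<le> 0"
      by (intro convex_polynomial_system_attained) (auto split: sum.split simp: p g)
    then obtain x where x: "\<And>k. case_sum p g k x \<le> 0"
      by auto
    have "p j x \<le> 0" "g i x \<le> 0" for j i
      using x[of "Inl j"] x[of "Inr i"] by auto
    then show False
      using infeasible by blast
  qed
  then obtain w b where b: "w \<bullet> 0 < b" "\<And>v. v \<in> closure \<Omega> \<Longrightarrow> w \<bullet> v > b"
    using separating_hyperplane_closed_point[of "closure \<Omega>" 0] \<open>convex \<Omega>\<close> by (auto simp: convex_closure)
  obtain \<delta> \<mu> where w: "w = (\<delta>, \<mu>)"
    by fastforce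
  have sep: "\<delta> \<bullet> y + \<mu> \<bullet> z > b" if "(y, z) \<in> \<Omega>" for y z
    using b(2)[of "(y, z)"] that closure_subset by (auto simp: w)
  define P where "P x = (\<chi> j. p j x)" for x
  define G where "G x = (\<chi> i. g i x)" for x
  have nonneg: "s \<ge> 0" if "\<And>t. t \<ge> 0 \<Longrightarrow> C + t * s > b" for s C :: real
  proof (rule ccontr)
    assume "\<not> ?thesis"
    then have "s < 0" by simp
    \<comment> \<open>At this \<open>t\<close> the value \<open>C + t * s\<close> has dropped to
      \<open>b\<close> or below.\<close>
    define t where "t = max 0 ((b - C) / s)"
    have "t * s \<le> b - C"
      using \<open>s < 0\<close> by (simp add: t_def max_def field_simps)
    then show False
      using that[of t] by (simp add: t_def)
  qed
  have "\<delta> $ j \<ge> 0" for j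
  proof (rule nonneg)
    fix t :: real
    assume "t \<ge> 0"
    \<comment> \<open>Raising one coordinate stays in \<open>\<Omega>\<close>, so the separating
      functional must not decrease in that direction.\<close>
    then have "(P 0 + t *\<^sub>R axis j 1, G 0) \<in> \<Omega>"
      by (auto simp: \<Omega>_def P_def G_def axis_def intro!: exI[of _ 0])
    from sep[OF this] show "(\<delta> \<bullet> P 0 + \<mu> \<bullet> G 0) + t * \<delta> $ j > b"
      by (simp add: inner_add_right inner_axis)
  qed
  moreover have "\<mu> $ i \<ge> 0" for i
  proof (rule nonneg)
    fix t :: real
    assume "t \<ge> 0"
    then have "(P 0, G 0 + t *\<^sub>R axis i 1) \<in> \<Omega>"
      by (auto simp: \<Omega>_def P_def G_def axis_def intro!: exI[of _ 0])
    from sep[OF this] show "(\<delta> \<bullet> P 0 + \<mu> \<bullet> G 0) + t * \<mu> $ i > b"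
      by (simp add: inner_add_right inner_axis)
  qed
  moreover have "(\<Sum>j\<in>UNIV. \<delta> $ j * p j x) + (\<Sum>i\<in>UNIV. \<mu> $ i * g i x) > b" for x
    using sep[of "P x" "G x"] by (auto simp: \<Omega>_def P_def G_def inner_vec_def)
  ultimately have "\<delta> \<in> nonneg_orthant" "\<mu> \<in> nonneg_orthant"
    "\<forall>x. (\<Sum>j\<in>UNIV. \<delta> $ j * p j x) + (\<Sum>i\<in>UNIV. \<mu> $ i * g i x) > b"
    by (simp_all add: nonneg_orthant_def)
  moreover have "b > 0"
    using b(1) by simp
  ultimately show ?thesis
    by blast
qed

section \<open>The equivalence: normalised multipliers, and the converse by averaging\<close>

theorem theorem2p4:
  fixes p :: "'r::finite \<Rightarrow> real ^ 'n::finite \<Rightarrow> real"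
    and g :: "'m::finite \<Rightarrow> real ^ 'n \<Rightarrow> real"
  assumes p_convex: "\<And>j. convex_polynomial (p j)"
    and g_convex: "\<And>i. convex_polynomial (g i)"
    and feasible: "feasible_set g \<noteq> {}"
  shows "(\<forall>x. (\<forall>i. g i x \<le> 0) \<longrightarrow> (MAX j. p j x) \<ge> 0) \<longleftrightarrow>
    (\<forall>\<epsilon>>0. \<exists>\<delta> \<in> prob_simplex. \<exists>\<mu> \<in> nonneg_orthant. \<forall>x.
      (\<Sum>j\<in>UNIV. \<delta> $ j * p j x) + (\<Sum>i\<in>UNIV. \<mu> $ i * g i x) + \<epsilon> > 0)"
proof (intro iffI allI impI)
  fix \<epsilon> :: real
  assume i: "\<forall>x. (\<forall>i. g i x \<le> 0) \<longrightarrow> (MAX j. p j x) \<ge> 0" and \<epsilon>: "\<epsilon> > 0"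
  \<comment> \<open>At a feasible point some \<open>p j\<close> attains the nonnegative maximum, and
    adding \<epsilon> makes it positive.\<close>
  have "\<nexists>x. (\<forall>j. p j x + \<epsilon> \<le> 0) \<and> (\<forall>i. g i x \<le> 0)"
  proof clarify
    fix x
    assume le: "\<forall>j. p j x + \<epsilon> \<le> 0" and "\<forall>i. g i x \<le> 0"
    then obtain j where "p j x \<ge> 0"
      using i by (auto simp: Max_ge_iff)
    moreover have "p j x + \<epsilon> \<le> 0"
      using le ..
    ultimately show False
      using \<epsilon> by linarith
  qed
  from convex_polynomial_systems_alternative[OF convex_polynomial_add_const[OF p_convex] g_convex this]
  obtain \<delta> \<mu> b where \<delta>: "\<delta> \<in> nonneg_orthant" and \<mu>: "\<mu> \<in> nonneg_orthant" and "b > 0"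
    and gt: "\<And>x. (\<Sum>j\<in>UNIV. \<delta> $ j * (p j x + \<epsilon>)) + (\<Sum>i\<in>UNIV. \<mu> $ i * g i x) > b"
    by (elim bexE exE conjE) (simp only: that)
  define s where "s = (\<Sum>j\<in>UNIV. \<delta> $ j)"
  \<comment> \<open>If all weights of the \<open>p j\<close> vanished, only the \<open>g\<close>
    terms would remain; at a feasible point their sum is at most 0, against the margin
    \<open>b > 0\<close>.\<close>
  have "s \<noteq> 0"
  proof
    assume "s = 0"
    then have "\<delta> $ j = 0" for j
      using \<delta> by (simp add: s_def nonneg_orthant_def sum_nonneg_eq_0_iff)
    moreover obtain x where "\<And>i. g i x \<le> 0"
      using feasible by (auto simp: feasible_set_def)
    then have "(\<Sum>i\<in>UNIV. \<mu> $ i * g i x) \<le> 0"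
      using \<mu> by (intro sum_nonpos) (simp add: nonneg_orthant_def mult_nonneg_nonpos)
    ultimately show False
      using gt[of x] \<open>b > 0\<close> by simp
  qed
  moreover have "s \<ge> 0"
    using \<delta> by (simp add: s_def nonneg_orthant_def sum_nonneg)
  ultimately have "s > 0"
    by simp
  \<comment> \<open>Dividing by \<open>s\<close> turns the weights into a point of the simplex and
    the accumulated shift \<open>s * \<epsilon>\<close> into \<epsilon>.\<close>
  have "(1 / s) *\<^sub>R \<delta> \<in> prob_simplex"
    using \<delta> \<open>s > 0\<close>
    by (simp add: prob_simplex_def nonneg_orthant_def sum_divide_distrib[symmetric] s_def[symmetric])
  moreover have "(1 / s) *\<^sub>R \<mu> \<in> nonneg_orthant"
    using \<mu> \<open>s > 0\<close> by (simp add: nonneg_orthant_def)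
  moreover have "(\<Sum>j\<in>UNIV. ((1 / s) *\<^sub>R \<delta>) $ j * p j x) + (\<Sum>i\<in>UNIV. ((1 / s) *\<^sub>R \<mu>) $ i * g i x) + \<epsilon> > 0" for x
  proof -
    let ?A = "\<Sum>j\<in>UNIV. \<delta> $ j * p j x" and ?B = "\<Sum>i\<in>UNIV. \<mu> $ i * g i x"
    have "?A + s * \<epsilon> + ?B > 0"
      using gt[of x] \<open>b > 0\<close> by (simp add: distrib_left sum.distrib s_def sum_distrib_right)
    then have "(?A + s * \<epsilon> + ?B) / s > 0"
      using \<open>s > 0\<close> by simp
    then show ?thesis
      using \<open>s > 0\<close> by (simp add: add_divide_distrib sum_divide_distrib)
  qed
  ultimately show "\<exists>\<delta>\<in>prob_simplex. \<exists>\<mu>\<in>nonneg_orthant. \<forall>x.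
      (\<Sum>j\<in>UNIV. \<delta> $ j * p j x) + (\<Sum>i\<in>UNIV. \<mu> $ i * g i x) + \<epsilon> > 0"
    by (intro bexI[of _ "(1 / s) *\<^sub>R \<delta>"] bexI[of _ "(1 / s) *\<^sub>R \<mu>"] allI)
next
  fix x
  assume ii: "\<forall>\<epsilon>>0. \<exists>\<delta>\<in>prob_simplex. \<exists>\<mu>\<in>nonneg_orthant. \<forall>x.
      (\<Sum>j\<in>UNIV. \<delta> $ j * p j x) + (\<Sum>i\<in>UNIV. \<mu> $ i * g i x) + \<epsilon> > 0"
    and x: "\<forall>i. g i x \<le> 0"
  show "(MAX j. p j x) \<ge> 0"
  \<comment> \<open>At a feasible \<open>x\<close> the \<open>g\<close> terms only lower the sum,
    and a weighted average of the \<open>p j x\<close> is at most their maximum. So the maximum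
    exceeds -\<epsilon> for every positive \<epsilon>.\<close>
  proof (rule field_le_epsilon)
    fix \<epsilon> :: real
    assume "\<epsilon> > 0"
    from ii[THEN spec, THEN mp, OF this] obtain \<delta> \<mu> where \<delta>: "\<delta> \<in> prob_simplex" and \<mu>: "\<mu> \<in> nonneg_orthant"
      and pos: "(\<Sum>j\<in>UNIV. \<delta> $ j * p j x) + (\<Sum>i\<in>UNIV. \<mu> $ i * g i x) + \<epsilon> > 0"
      by (elim bexE) (simp only: that)
    have "(\<Sum>j\<in>UNIV. \<delta> $ j * p j x) \<le> (\<Sum>j\<in>UNIV. \<delta> $ j * (MAX j. p j x))"
      using \<delta> by (intro sum_mono mult_left_mono) (auto simp: prob_simplex_def nonneg_orthant_def)
    also have "\<dots> = (MAX j. p j x)"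
      using \<delta> by (simp add: prob_simplex_def sum_distrib_right[symmetric])
    finally have "(\<Sum>j\<in>UNIV. \<delta> $ j * p j x) \<le> (MAX j. p j x)" .
    moreover have "(\<Sum>i\<in>UNIV. \<mu> $ i * g i x) \<le> 0"
      using \<mu> x by (intro sum_nonpos) (simp add: nonneg_orthant_def mult_nonneg_nonpos)
    ultimately show "0 \<le> (MAX j. p j x) + \<epsilon>"
      using pos by linarith
  qed
qed

end
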